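(* For every prime power $q$, the alternating forms graph $\mathrm{Alt}(5,q)$ is not triply transitive.
   Context: $\mathrm{Alt}(5,q)$ has as vertices the $5\times5$ skew-symmetric (alternating) matrices over $\mathbb F_q$, two matrices being adjacent iff their difference has rank $2$. For a strongly regular graph $\Gamma=(V,E)$: $A_0=I$, $A_1$ its adjacency matrix, $A_2=J-I-A_1$; for a vertex $\omega$, $E^*_{i,\omega}$ ($i=0,1,2$) is the diagonal matrix whose diagonal is the $\omega$-row of $A_i$; $T_\omega$ is the algebra generated by $A_0,A_1,A_2,E^*_{0,\omega},E^*_{1,\omega},E^*_{2,\omega}$; $T_{0,\omega}$ is the span of all $E^*_{i,\omega}A_jE^*_{k,\omega}$; $\tilde T_\omega$ is the algebra of complex matrices commuting with the permutation matrices of the stabilizer $G_\omega$ in $G=\mathrm{Aut}(\Gamma)$. $\Gamma$ is triply transitive if $G$ is transitive and $T_{0,\omega}=T_\omega=\tilde T_\omega$ for some (equivalently every) vertex $\omega$. *)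

theory Defs
  imports "HOL-Analysis.Analysis" "HOL-Library.Numeral_Type" "HOL-Number_Theory.Prime_Powers"
begin

text \<open>
  The library has no complex vector space structure on \<open>complex ^ 'v ^ 'v\<close>, so we supply it; the
  matrix product is the library's \<open>**\<close>.
\<close>

definition mat_scale :: "complex \<Rightarrow> complex ^ 'v ^ 'v \<Rightarrow> complex ^ 'v ^ 'v" where
  "mat_scale c A = (\<chi> i j. c * A $ i $ j)"

global_interpretation cmat: vector_space "mat_scale :: complex \<Rightarrow> complex ^ 'v ^ 'v \<Rightarrow> _"
  by unfold_locales (simp_all add: mat_scale_def vec_eq_iff algebra_simps)

definition mat_subalgebra :: "(complex ^ 'v ^ 'v) set \<Rightarrow> bool" where
  "mat_subalgebra S \<longleftrightarrow> cmat.subspace S \<and> mat 1 \<in> S \<and> (\<forall>A\<in>S. \<forall>B\<in>S. A ** B \<in> S)"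

definition generated_algebra :: "(complex ^ 'v ^ 'v) set \<Rightarrow> (complex ^ 'v ^ 'v) set" where
  "generated_algebra S = mat_subalgebra hull S"

text \<open>
  A finite graph is given by its adjacency relation \<open>adj\<close> on a finite type \<open>'v\<close> of vertices. The
  definitions below are intended for strongly regular graphs, but do not depend on the parameters
  of the graph.
\<close>

definition rel_mat :: "('v \<Rightarrow> 'v \<Rightarrow> bool) \<Rightarrow> nat \<Rightarrow> complex ^ 'v ^ 'v" where
  "rel_mat adj i =
     (let I = mat 1; J = (\<chi> x y. 1); A = (\<chi> x y. if adj x y then 1 else 0)
      in if i = 0 then I else if i = 1 then A else J - I - A)"

definition dual_idem :: "('v \<Rightarrow> 'v \<Rightarrow> bool) \<Rightarrow> 'v \<Rightarrow> nat \<Rightarrow> complex ^ 'v ^ 'v" where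
  "dual_idem adj \<omega> i = (\<chi> x y. if x = y then rel_mat adj i $ \<omega> $ x else 0)"

definition terwilliger :: "('v \<Rightarrow> 'v \<Rightarrow> bool) \<Rightarrow> 'v \<Rightarrow> (complex ^ 'v ^ 'v) set" where
  "terwilliger adj \<omega> =
     generated_algebra (rel_mat adj ` {0, 1, 2} \<union> dual_idem adj \<omega> ` {0, 1, 2})"

definition terwilliger0 :: "('v \<Rightarrow> 'v \<Rightarrow> bool) \<Rightarrow> 'v \<Rightarrow> (complex ^ 'v ^ 'v) set" where
  "terwilliger0 adj \<omega> =
     cmat.span {dual_idem adj \<omega> i ** rel_mat adj j ** dual_idem adj \<omega> k | i j k.
       i \<in> {0, 1, 2} \<and> j \<in> {0, 1, 2} \<and> k \<in> {0, 1, 2}}"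

definition graph_aut :: "('v \<Rightarrow> 'v \<Rightarrow> bool) \<Rightarrow> ('v \<Rightarrow> 'v) set" where
  "graph_aut adj = {g. bij g \<and> (\<forall>x y. adj (g x) (g y) \<longleftrightarrow> adj x y)}"

definition perm_mat :: "('v \<Rightarrow> 'v) \<Rightarrow> complex ^ 'v ^ 'v" where
  "perm_mat g = (\<chi> x y. if x = g y then 1 else 0)"

definition terwilliger_tilde :: "('v \<Rightarrow> 'v \<Rightarrow> bool) \<Rightarrow> 'v \<Rightarrow> (complex ^ 'v ^ 'v) set" where
  "terwilliger_tilde adj \<omega> =
     {M. \<forall>g\<in>graph_aut adj. g \<omega> = \<omega> \<longrightarrow> M ** perm_mat g = perm_mat g ** M}"

definition triply_transitive :: "('v::finite \<Rightarrow> 'v \<Rightarrow> bool) \<Rightarrow> bool" where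
  "triply_transitive adj \<longleftrightarrow>
     (\<forall>x y. \<exists>g\<in>graph_aut adj. g x = y) \<and>
     (\<exists>\<omega>. terwilliger0 adj \<omega> = terwilliger adj \<omega> \<and> terwilliger adj \<omega> = terwilliger_tilde adj \<omega>)"

text \<open>
  The zero diagonal does not follow from skew-symmetry in characteristic 2. The type
  \<open>('a, 'n) alt_mat\<close> with adjacency \<open>alt_adj\<close> is the graph \<open>Alt(n, q)\<close> with \<open>n = CARD('n)\<close>
  and \<open>q = CARD('a)\<close>.
\<close>

typedef (overloaded) ('a::field, 'n::finite) alt_mat =
  "{A :: 'a ^ 'n ^ 'n. transpose A = - A \<and> (\<forall>i. A $ i $ i = 0)}"
  morphisms mat_of_alt alt_of_mat
  by (rule exI[of _ 0]) (simp add: transpose_def vec_eq_iff)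

instance alt_mat :: ("{field, finite}", finite) finite
proof
  have "inj (mat_of_alt :: ('a, 'b) alt_mat \<Rightarrow> _)"
    by (simp add: inj_def mat_of_alt_inject)
  then show "finite (UNIV :: ('a, 'b) alt_mat set)"
    by (rule finite_imageD[rotated]) simp
qed

definition alt_adj :: "('a::field, 'n::finite) alt_mat \<Rightarrow> ('a, 'n) alt_mat \<Rightarrow> bool" where
  "alt_adj A B \<longleftrightarrow> rank (mat_of_alt A - mat_of_alt B) = 2"

end

theory Submission
  imports Defs
begin

text \<open>
  If \<open>T\<^sub>0 = T\<close> at \<open>\<omega>\<close>, then the number of common neighbours of \<open>\<omega>\<close>, \<open>x\<close> and \<open>y\<close> depends only on the
  relations between \<open>\<omega>\<close>, \<open>x\<close> and \<open>y\<close>, since it is the \<open>(x, y)\<close> entry of \<open>A\<^sub>1 E\<^sub>1\<^sup>* A\<^sub>1 \<in> T\<close>. After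
  translating \<open>\<omega>\<close> to \<open>0\<close>, consider pairs \<open>X\<close>, \<open>Y\<close> such that \<open>X\<close>, \<open>Y\<close> and \<open>X - Y\<close> have rank 4. A common
  neighbour \<open>Z\<close> of \<open>0\<close> and \<open>X\<close> has rank 2 and contains the radical of \<open>X\<close> in its radical. If \<open>X\<close> and \<open>Y\<close>
  have the same radical, \<open>Z\<close> ranges over the intersection of a quadric with two affine hyperplanes
  in a space of dimension 6, and there are at least \<open>q\<^sup>2\<close> common neighbours. If the radicals are
  distinct, then \<open>Z\<close> ranges over the intersection of two affine planes in a space of dimension 3,
  and there are pairs with at most \<open>q\<close> common neighbours.
\<close>

section \<open>Alternating matrices: wedges, Pfaffians and rank 2\<close>

definition wedge :: "'a::field ^ 'n \<Rightarrow> 'a ^ 'n \<Rightarrow> 'a ^ 'n ^ 'n" where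
  "wedge u v = (\<chi> i j. u $ i * v $ j - u $ j * v $ i)"

definition alternating :: "'a::field ^ 'n ^ 'n \<Rightarrow> bool" where
  "alternating A \<longleftrightarrow> transpose A = - A \<and> (\<forall>i. A $ i $ i = 0)"

text \<open>
  The Pfaffian of the principal submatrix on \<open>i\<close>, \<open>j\<close>, \<open>k\<close>, \<open>l\<close>; the indices need not be distinct.
\<close>

definition pf4 :: "'a::field ^ 'n ^ 'n \<Rightarrow> 'n \<Rightarrow> 'n \<Rightarrow> 'n \<Rightarrow> 'n \<Rightarrow> 'a" where
  "pf4 A i j k l = A $ i $ j * A $ k $ l - A $ i $ k * A $ j $ l + A $ i $ l * A $ j $ k"

lemma alternating_iff:
  "alternating A \<longleftrightarrow> (\<forall>i j. A $ i $ j + A $ j $ i = 0) \<and> (\<forall>i. A $ i $ i = 0)"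
  by (simp add: alternating_def transpose_def vec_eq_iff eq_neg_iff_add_eq_0 add.commute)

lemma alternating_wedge: "alternating (wedge u v)"
  by (simp add: alternating_iff wedge_def)

lemma alternating_add:
  assumes "alternating A" "alternating B"
  shows "alternating (A + B)"
proof -
  have "(A + B) $ i $ j + (A + B) $ j $ i = (A $ i $ j + A $ j $ i) + (B $ i $ j + B $ j $ i)" for i j
    by simp
  with assms show ?thesis
    unfolding alternating_iff by simp
qed

lemma alternating_uminus:
  assumes "alternating A"
  shows "alternating (- A)"
proof -
  have "(- A) $ i $ j + (- A) $ j $ i = - (A $ i $ j + A $ j $ i)" for i j
    by simp
  with assms show ?thesis
    unfolding alternating_iff by simp
qed

lemma alternating_diff: "alternating A \<Longrightarrow> alternating B \<Longrightarrow> alternating (A - B)"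
  using alternating_add[of A "- B"] alternating_uminus[of B] by simp

lemma alternating_mat_of_alt: "alternating (mat_of_alt A)"
  using mat_of_alt[of A] unfolding alternating_def by simp

lemma mat_of_alt_of_mat: "alternating A \<Longrightarrow> mat_of_alt (alt_of_mat A) = A"
  by (rule alt_of_mat_inverse) (simp add: alternating_def)

lemma pf4_wedge: "pf4 (wedge u v) i j k l = 0"
  unfolding pf4_def wedge_def by (simp, algebra)

lemma pf4_uminus: "pf4 (- A) i j k l = pf4 A i j k l"
  by (simp add: pf4_def)

text \<open>The bracket is the polar form of the quadratic form \<open>pf4\<close>. If the Pfaffians
  of \<open>B\<close> and \<open>A - B\<close> vanish, a linear equation for \<open>B\<close>
  remains.\<close>

lemma pf4_diff:
  "pf4 (A - B) i j k l = pf4 A i j k l + pf4 B i j k l -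
    (A $ i $ j * B $ k $ l + A $ k $ l * B $ i $ j - A $ i $ k * B $ j $ l - A $ j $ l * B $ i $ k +
     A $ i $ l * B $ j $ k + A $ j $ k * B $ i $ l)"
  unfolding pf4_def by (simp, algebra)

text \<open>If \<open>A $ i $ j\<close> is nonzero, a vanishing Pfaffian can be solved for
  \<open>A $ k $ l\<close>, so rows \<open>i\<close> and \<open>j\<close> span all rows. The zero
  diagonal and skew-symmetry make these two independent.\<close>

lemma rank_eq_2_of_pf4:
  fixes A :: "'a::field ^ 'n ^ 'n"
  assumes alt: "alternating A" and nz: "A \<noteq> 0" and pf: "\<And>i j k l. pf4 A i j k l = 0"
  shows "rank A = 2"
proof -
  obtain i j where ij: "A $ i $ j \<noteq> 0"
    using nz by (auto simp: vec_eq_iff)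
  have skew: "A $ m $ n = - A $ n $ m" and diag: "A $ n $ n = 0" for m n
    using alt by (simp_all add: alternating_iff eq_neg_iff_add_eq_0)
  define B where "B = {row i A, row j A}"
  have ne: "row i A \<noteq> row j A"
  proof
    assume "row i A = row j A"
    then have "row i A $ j = row j A $ j" by simp
    then show False using ij diag[of j] by (simp add: row_def)
  qed
  have rowk: "row k A = (A $ i $ k / A $ i $ j) *s row j A - (A $ j $ k / A $ i $ j) *s row i A" for k
  proof -
    have "A $ i $ j * A $ k $ l = A $ i $ k * A $ j $ l - A $ i $ l * A $ j $ k" for l
      using pf[of i j k l] by (simp add: pf4_def algebra_simps)
    then show ?thesis
      using ij by (simp add: vec_eq_iff row_def field_simps)
  qed
  have "row k A \<in> vec.span B" for k
    unfolding rowk[of k] by (intro vec.span_diff vec.span_scale vec.span_base) (simp_all add: B_def)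
  then have "rows A \<subseteq> vec.span B"
    by (auto simp: rows_def)
  moreover have "B \<subseteq> rows A"
    by (auto simp: B_def rows_def)
  moreover have "vec.independent B"
  proof -
    have "row i A \<noteq> c *s row j A" for c
    proof
      assume "row i A = c *s row j A"
      then have "row i A $ j = (c *s row j A) $ j" by simp
      then show False using ij diag[of j] by (simp add: row_def)
    qed
    moreover have "row j A \<noteq> 0"
    proof
      assume "row j A = 0"
      then have "row j A $ i = 0" by simp
      then show False using ij skew[of j i] by (simp add: row_def)
    qed
    ultimately have "row i A \<notin> vec.span {row j A}" "vec.independent {row j A}"
      by (auto simp only: vec.span_singleton vec.dependent_single)
    then show ?thesis
      using ne by (simp add: B_def vec.independent_insert)
  qed
  moreover have "card B = 2"
    using ne by (simp add: B_def)
  ultimately have "vec.dim (rows A) = 2"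
    using vec.dim_unique by metis
  then show ?thesis
    by (simp add: row_rank_def_gen)
qed

lemma independent_3:
  fixes u v w :: "'a::field ^ 'n"
  assumes "\<And>a b c. a *s u + b *s v + c *s w = 0 \<Longrightarrow> a = 0 \<and> b = 0 \<and> c = 0"
  shows "vec.independent {u, v, w}" "card {u, v, w} = 3"
proof -
  have ne: "u \<noteq> v" "u \<noteq> w" "v \<noteq> w"
    using assms[of 1 "-1" 0] assms[of 1 0 "-1"] assms[of 0 1 "-1"] by auto
  then show "card {u, v, w} = 3"
    by simp
  have "w \<noteq> 0"
    using assms[of 0 0 1] by auto
  have "v \<noteq> c *s w" for c
    using assms[of 0 1 "-c"] by auto
  moreover have "u - b *s v \<noteq> c *s w" for b c
  proof
    assume "u - b *s v = c *s w"
    then have "1 *s u + (-b) *s v + (-c) *s w = 0"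
      by (simp add: algebra_simps)
    from assms[OF this] show False by simp
  qed
  ultimately have "v \<notin> vec.span {w}" "u \<notin> vec.span {v, w}"
    unfolding vec.span_insert[of v] vec.span_singleton by blast+
  with \<open>w \<noteq> 0\<close> show "vec.independent {u, v, w}"
    by (simp add: vec.independent_insert)
qed

text \<open>A nonzero Pfaffian makes rows \<open>i\<close>, \<open>j\<close>, \<open>k\<close>
  independent, which forces rank at least 3.\<close>

lemma pf4_of_rank_2:
  fixes A :: "'a::field ^ 'n ^ 'n"
  assumes alt: "alternating A" and rk: "rank A = 2"
  shows "pf4 A i j k l = 0"
proof (rule ccontr)
  assume pf: "pf4 A i j k l \<noteq> 0"
  have skew: "A $ m $ n = - A $ n $ m" and diag: "A $ n $ n = 0" for m n
    using alt by (simp_all add: alternating_iff eq_neg_iff_add_eq_0)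
  have *: "a = 0 \<and> b = 0 \<and> c = 0" if "a *s row i A + b *s row j A + c *s row k A = 0" for a b c
  proof -
    have col: "a * A $ i $ m + b * A $ j $ m + c * A $ k $ m = 0" for m
      using that by (simp add: vec_eq_iff row_def)
    have ci: "b * A $ i $ j + c * A $ i $ k = 0"
      using col[of i] skew[of j i] skew[of k i] diag[of i] by algebra
    have cj: "a * A $ i $ j = c * A $ j $ k"
      using col[of j] skew[of k j] diag[of j] by algebra
    have ck: "a * A $ i $ k + b * A $ j $ k = 0"
      using col[of k] diag[of k] by simp
    \<comment> \<open>Columns \<open>i\<close>, \<open>j\<close>, \<open>k\<close> make
      \<open>(a, b, c)\<close> proportional to \<open>(A $ j $ k, - A $ i $ k, A $ i $ j)\<close>,
      and pairing the latter with column \<open>l\<close> gives the Pfaffian.\<close>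
    have "a * pf4 A i j k l = 0" "b * pf4 A i j k l = 0" "c * pf4 A i j k l = 0"
      unfolding pf4_def using ci cj ck col[of l] by algebra+
    with pf show ?thesis by simp
  qed
  have "vec.independent {row i A, row j A, row k A}"
    by (rule independent_3(1), rule *)
  then have "card {row i A, row j A, row k A} \<le> vec.dim (rows A)"
    by (intro vec.independent_card_le_dim) (auto simp: rows_def)
  moreover have "card {row i A, row j A, row k A} = 3"
    by (rule independent_3(2), rule *)
  ultimately show False
    using rk by (simp add: row_rank_def_gen)
qed

lemma rank_eq_2_iff:
  assumes "alternating A"
  shows "rank A = 2 \<longleftrightarrow> A \<noteq> 0 \<and> (\<forall>i j k l. pf4 A i j k l = 0)"
proof -
  have "rank (0 :: 'a ^ 'n ^ 'n) \<noteq> 2"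
    by (simp add: row_rank_def_gen rows_def row_def flip: zero_vec_def)
  then show ?thesis
    using rank_eq_2_of_pf4[of A] pf4_of_rank_2[of A] assms by blast
qed

lemma rank_wedge:
  assumes "wedge u v $ i $ j \<noteq> 0"
  shows "rank (wedge u v) = 2"
  using assms by (auto simp: rank_eq_2_iff alternating_wedge pf4_wedge)

text \<open>One nonzero Pfaffian certifies that two vertices with difference \<open>A\<close> are
  distinct and nonadjacent.\<close>

lemma not_rank_2:
  assumes "alternating A" "pf4 A i j k l \<noteq> 0"
  shows "A \<noteq> 0" "rank A \<noteq> 2"
  using assms by (auto simp: rank_eq_2_iff pf4_def)

lemma rank_2_uminus:
  assumes "alternating A"
  shows "rank (- A) = 2 \<longleftrightarrow> rank A = 2"
  using assms by (simp add: rank_eq_2_iff pf4_uminus alternating_uminus)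

section \<open>Entries of the Terwilliger algebra and triple intersection numbers\<close>

text \<open>Each spanning matrix has as entry a product of three factors, one for each pair among
  \<open>\<omega>\<close>, \<open>x\<close>, \<open>y\<close>, and each factor sees only the
  relation of its pair.\<close>

lemma terwilliger0_entry_cong:
  assumes "M \<in> terwilliger0 adj \<omega>"
    and "x = \<omega> \<longleftrightarrow> x' = \<omega>" "y = \<omega> \<longleftrightarrow> y' = \<omega>" "x = y \<longleftrightarrow> x' = y'"
    and "adj \<omega> x \<longleftrightarrow> adj \<omega> x'" "adj \<omega> y \<longleftrightarrow> adj \<omega> y'" "adj x y \<longleftrightarrow> adj x' y'"
  shows "M $ x $ y = M $ x' $ y'"
proof -
  have entry: "(dual_idem adj \<omega> i ** rel_mat adj j ** dual_idem adj \<omega> k) $ u $ v =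
      rel_mat adj i $ \<omega> $ u * rel_mat adj j $ u $ v * rel_mat adj k $ \<omega> $ v" for i j k u v
    by (simp add: matrix_matrix_mult_def dual_idem_def if_distrib[of "\<lambda>t. t * _"]
        if_distrib[of "\<lambda>t. _ * t"] cong: if_cong)
  have rel: "rel_mat adj i $ \<omega> $ x = rel_mat adj i $ \<omega> $ x'"
    "rel_mat adj i $ \<omega> $ y = rel_mat adj i $ \<omega> $ y'"
    "rel_mat adj i $ x $ y = rel_mat adj i $ x' $ y'" for i
    using assms(2-) by (auto simp: rel_mat_def mat_def Let_def)
  from assms(1) show ?thesis
    unfolding terwilliger0_def
  proof (induction rule: cmat.span_induct_alt)
    case base
    show ?case by simp
  next
    case (step c B C)
    then show ?case
      by (auto simp: mat_scale_def entry rel)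
  qed
qed

lemma terwilliger_common_neighbours:
  "rel_mat adj 1 ** dual_idem adj \<omega> 1 ** rel_mat adj 1 \<in> terwilliger adj \<omega>"
proof -
  have sub: "mat_subalgebra (terwilliger adj \<omega>)"
    unfolding terwilliger_def generated_algebra_def
    by (rule hull_in) (auto simp: mat_subalgebra_def intro!: cmat.subspace_Inter)
  have "rel_mat adj 1 \<in> terwilliger adj \<omega>" "dual_idem adj \<omega> 1 \<in> terwilliger adj \<omega>"
    unfolding terwilliger_def generated_algebra_def by (auto intro!: hull_inc)
  with sub show ?thesis
    by (simp add: mat_subalgebra_def)
qed

text \<open>The diagonal factor restricts the sum over walks of length 2 to midpoints adjacent to
  \<open>\<omega>\<close>.\<close>

lemma common_neighbours_entry:
  fixes x y \<omega> :: "'v::finite"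
  shows "(rel_mat adj 1 ** dual_idem adj \<omega> 1 ** rel_mat adj 1) $ x $ y =
    of_nat (card {z. adj x z \<and> adj \<omega> z \<and> adj z y})"
proof -
  have "(rel_mat adj 1 ** dual_idem adj \<omega> 1 ** rel_mat adj 1) $ x $ y =
      (\<Sum>z\<in>UNIV. rel_mat adj 1 $ x $ z * rel_mat adj 1 $ \<omega> $ z * rel_mat adj 1 $ z $ y)"
    by (simp add: matrix_matrix_mult_def dual_idem_def if_distrib[of "\<lambda>t. t * _"]
        if_distrib[of "\<lambda>t. _ * t"] cong: if_cong)
  also have "\<dots> = (\<Sum>z\<in>UNIV. if adj x z \<and> adj \<omega> z \<and> adj z y then 1 else 0)"
    by (intro sum.cong) (auto simp: rel_mat_def)
  finally show ?thesis
    by (simp add: sum.If_cases)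
qed

lemma exhaust_5:
  fixes x :: 5
  shows "x = 0 \<or> x = 1 \<or> x = 2 \<or> x = 3 \<or> x = 4"
proof (induct x)
  case (of_int z)
  then have "z = 0 \<or> z = 1 \<or> z = 2 \<or> z = 3 \<or> z = 4" by fastforce
  then show ?case by auto
qed

lemma forall_5: "(\<forall>x::5. P x) \<longleftrightarrow> P 0 \<and> P 1 \<and> P 2 \<and> P 3 \<and> P 4"
  by (metis exhaust_5)

section \<open>Common neighbours after translating \<open>\<omega>\<close> to the zero
  matrix\<close>

definition rank2_common :: "'a::field ^ 'n ^ 'n \<Rightarrow> 'a ^ 'n ^ 'n \<Rightarrow> ('a ^ 'n ^ 'n) set" where
  "rank2_common X Y = {Z. alternating Z \<and> rank Z = 2 \<and> rank (X - Z) = 2 \<and> rank (Y - Z) = 2}"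

text \<open>Meaningful for alternating \<open>X\<close> only, as \<open>alt_of_mat\<close> is
  unspecified elsewhere.\<close>

definition translate :: "('a::field, 'n::finite) alt_mat \<Rightarrow> 'a ^ 'n ^ 'n \<Rightarrow> ('a, 'n) alt_mat" where
  "translate \<omega> X = alt_of_mat (mat_of_alt \<omega> + X)"

lemma mat_of_translate:
  "alternating X \<Longrightarrow> mat_of_alt (translate \<omega> X) = mat_of_alt \<omega> + X"
  by (simp add: translate_def mat_of_alt_of_mat alternating_add alternating_mat_of_alt)

lemma translate_eq_iff:
  "alternating X \<Longrightarrow> alternating Y \<Longrightarrow> translate \<omega> X = translate \<omega> Y \<longleftrightarrow> X = Y"
  by (metis mat_of_translate add_left_cancel)

lemma translate_0: "translate \<omega> 0 = \<omega>"
  by (simp add: translate_def mat_of_alt_inverse)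

lemma translate_diff: "translate \<omega> (mat_of_alt z - mat_of_alt \<omega>) = z"
  by (simp add: translate_def mat_of_alt_inverse)

lemma alt_adj_translate:
  "alternating X \<Longrightarrow> alternating Y \<Longrightarrow> alt_adj (translate \<omega> X) (translate \<omega> Y) \<longleftrightarrow> rank (X - Y) = 2"
  by (simp add: alt_adj_def mat_of_translate)

lemma alt_adj_translate_0:
  "alternating X \<Longrightarrow> alt_adj \<omega> (translate \<omega> X) \<longleftrightarrow> rank X = 2"
  by (simp add: alt_adj_def mat_of_translate rank_2_uminus)

lemma card_common_neighbours:
  fixes \<omega> :: "('a::{field, finite}, 'n::finite) alt_mat"
  assumes X: "alternating X" and Y: "alternating Y"
  shows "card {z. alt_adj (translate \<omega> X) z \<and> alt_adj \<omega> z \<and> alt_adj z (translate \<omega> Y)} =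
    card (rank2_common X Y)"
proof -
  have adj: "alt_adj (translate \<omega> X) (translate \<omega> Z) \<and> alt_adj \<omega> (translate \<omega> Z) \<and>
      alt_adj (translate \<omega> Z) (translate \<omega> Y) \<longleftrightarrow> Z \<in> rank2_common X Y" if "alternating Z" for Z
    using that X Y rank_2_uminus[OF alternating_diff[OF Y that]]
    by (auto simp: alt_adj_translate alt_adj_translate_0 rank2_common_def)
  have "{z. alt_adj (translate \<omega> X) z \<and> alt_adj \<omega> z \<and> alt_adj z (translate \<omega> Y)} =
      translate \<omega> ` rank2_common X Y" (is "?L = _ ` ?R")
  proof (intro set_eqI iffI)
    fix z assume z: "z \<in> ?L"
    define Z where "Z = mat_of_alt z - mat_of_alt \<omega>"
    have "alternating Z" "z = translate \<omega> Z"
      by (simp_all add: Z_def alternating_diff alternating_mat_of_alt translate_diff)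
    with z adj show "z \<in> translate \<omega> ` ?R"
      by blast
  next
    fix z assume "z \<in> translate \<omega> ` ?R"
    then show "z \<in> ?L"
      using adj by (auto simp: rank2_common_def)
  qed
  moreover have "inj_on (translate \<omega>) (rank2_common X Y)"
    by (auto simp: inj_on_def rank2_common_def translate_eq_iff)
  ultimately show ?thesis
    by (simp add: card_image)
qed

text \<open>The assumptions make both triples consist of distinct, pairwise nonadjacent vertices, so
  all relations agree.\<close>

lemma card_rank2_common_eq:
  fixes \<omega> :: "('a::{field, finite}, 'n::finite) alt_mat" and X Y X' Y' :: "'a ^ 'n ^ 'n"
  assumes T: "terwilliger0 alt_adj \<omega> = terwilliger alt_adj \<omega>"
    and alt: "alternating X" "alternating Y" "alternating X'" "alternating Y'"
    and nz: "X \<noteq> 0" "Y \<noteq> 0" "X - Y \<noteq> 0" "X' \<noteq> 0" "Y' \<noteq> 0" "X' - Y' \<noteq> 0"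
    and rk: "rank X \<noteq> 2" "rank Y \<noteq> 2" "rank (X - Y) \<noteq> 2"
      "rank X' \<noteq> 2" "rank Y' \<noteq> 2" "rank (X' - Y') \<noteq> 2"
  shows "card (rank2_common X Y) = card (rank2_common X' Y')"
proof -
  have ne: "translate \<omega> Z \<noteq> \<omega>" if "alternating Z" "Z \<noteq> 0" for Z
    using translate_eq_iff[OF that(1), of 0 \<omega>] that(2) by (simp add: translate_0 alternating_iff)
  let ?M = "rel_mat alt_adj 1 ** dual_idem alt_adj \<omega> 1 ** rel_mat alt_adj 1"
  have "?M \<in> terwilliger0 alt_adj \<omega>"
    unfolding T by (rule terwilliger_common_neighbours)
  then have "?M $ translate \<omega> X $ translate \<omega> Y = ?M $ translate \<omega> X' $ translate \<omega> Y'"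
    by (rule terwilliger0_entry_cong)
      (use alt nz rk ne in \<open>simp_all add: translate_eq_iff alt_adj_translate alt_adj_translate_0\<close>)
  then have "(of_nat (card (rank2_common X Y)) :: complex) = of_nat (card (rank2_common X' Y'))"
    by (simp only: common_neighbours_entry card_common_neighbours alt)
  then show ?thesis by simp
qed

section \<open>Two explicit pairs of 5 x 5 matrices with different counts\<close>

abbreviation e :: "5 \<Rightarrow> 'a::field ^ 5" where
  "e i \<equiv> axis i 1"

text \<open>
  Both matrices have radical \<open>e 0\<close>. The parametrization \<open>f\<close> prescribes the entries 12, 13 and 14 of
  \<open>Z\<close> as \<open>s\<close>, \<open>t\<close> and 1; the remaining ones are forced by the vanishing Pfaffians.
\<close>

lemma card_rank2_common_ge:
  "CARD('a::{field, finite})\<^sup>2 \<le>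
    card (rank2_common (wedge (e 1) (e 2) + wedge (e 3) (e 4))
      (wedge (e 1) (e 2 + e 3) + wedge (e 4) (e 2)) :: ('a ^ 5 ^ 5) set)" (is "_ \<le> card (rank2_common ?X ?Y)")
proof -
  \<comment> \<open>The two vectors are rows 1 and 4 of \<open>Z\<close>; since entry 14 is 1,
    \<open>Z\<close> is their wedge.\<close>
  define f :: "'a \<times> 'a \<Rightarrow> 'a ^ 5 ^ 5" where
    "f = (\<lambda>(s, t). wedge (s *s e 2 + t *s e 3 + e 4) (- e 1 + (s - t) *s e 2 + (s - 1) *s e 3))"
  have entry: "f (s, t) $ 1 $ 2 = s" "f (s, t) $ 1 $ 3 = t" "f (s, t) $ 1 $ 4 = 1" for s t
    by (simp_all add: f_def wedge_def axis_def)
  have "inj f"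
    by (rule injI) (metis entry(1,2) surj_pair)
  have "f (s, t) \<in> rank2_common ?X ?Y" for s t
  proof -
    \<comment> \<open>Both differences have entry 14 equal to -1, so each is the wedge of its row 1
      and its negated row 4.\<close>
    have X: "?X - f (s, t) =
        wedge ((1 - s) *s e 2 - t *s e 3 - e 4) (- e 1 + (s - t) *s e 2 + s *s e 3)"
      by (simp add: vec_eq_iff forall_5 f_def wedge_def axis_def algebra_simps)
    have Y: "?Y - f (s, t) =
        wedge ((1 - s) *s e 2 + (1 - t) *s e 3 - e 4) (- e 1 + (s - t - 1) *s e 2 + (s - 1) *s e 3)"
      by (simp add: vec_eq_iff forall_5 f_def wedge_def axis_def algebra_simps)
    have "rank (f (s, t)) = 2"
      using entry(3)[of s t] unfolding f_def prod.case by (metis rank_wedge zero_neq_one)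
    moreover have "rank (?X - f (s, t)) = 2"
      unfolding X by (rule rank_wedge[of _ _ 1 4]) (simp add: wedge_def axis_def)
    moreover have "rank (?Y - f (s, t)) = 2"
      unfolding Y by (rule rank_wedge[of _ _ 1 4]) (simp add: wedge_def axis_def)
    ultimately show ?thesis
      by (simp add: rank2_common_def) (simp add: f_def alternating_wedge)
  qed
  then have "range f \<subseteq> rank2_common ?X ?Y"
    by auto
  then have "card (range f) \<le> card (rank2_common ?X ?Y)"
    by (intro card_mono) auto
  with \<open>inj f\<close> show ?thesis
    by (simp add: card_image power2_eq_square)
qed

text \<open>The radicals are \<open>e 4\<close> and \<open>e 0\<close>.\<close>

lemma card_rank2_common_le:
  "card (rank2_common (wedge (e 1) (e 0) + wedge (e 2) (e 3))
      (wedge (e 2) (e 4) + wedge (e 1) (e 3)) :: ('a ^ 5 ^ 5) set) \<le> CARD('a::{field, finite})"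
  (is "card (rank2_common ?X ?Y) \<le> _")
proof -
  \<comment> \<open>The linear equations from \<open>?X\<close> and \<open>?Y\<close> already fix
    every entry except 12 (and its negative 21).\<close>
  have entries: "Z = wedge (e 1) (Z $ 1 $ 2 *s e 2) + wedge (e 1) (e 3) + wedge (e 2) (e 3)"
    if "Z \<in> rank2_common ?X ?Y" for Z
  proof -
    have alt: "alternating Z" "alternating (?X - Z)" "alternating (?Y - Z)"
      using that by (auto simp: rank2_common_def alternating_wedge intro!: alternating_add alternating_diff)
    have pf: "pf4 Z i j k l = 0" "pf4 (?X - Z) i j k l = 0" "pf4 (?Y - Z) i j k l = 0" for i j k l
      using that pf4_of_rank_2 alt by (auto simp: rank2_common_def)
    have lin: "A $ i $ j * Z $ k $ l + A $ k $ l * Z $ i $ j - A $ i $ k * Z $ j $ l - A $ j $ l * Z $ i $ k +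
        A $ i $ l * Z $ j $ k + A $ j $ k * Z $ i $ l = pf4 A i j k l"
      if "A = ?X \<or> A = ?Y" for A i j k l
      using pf[of i j k l] pf4_diff[of A Z i j k l] that by auto
    note linX = lin[OF disjI1[OF refl]] and linY = lin[OF disjI2[OF refl]]
    have skew: "Z $ m $ n = - Z $ n $ m" and diag: "Z $ n $ n = 0" for m n
      using alt(1) by (simp_all add: alternating_iff eq_neg_iff_add_eq_0)
    have "Z $ 1 $ 4 = 0" "Z $ 2 $ 4 = 0" "Z $ 3 $ 4 = 0" "Z $ 4 $ 0 = 0"
      using linX[of 1 2 3 4] linX[of 1 2 4 0] linX[of 1 3 4 0] linX[of 2 3 4 0]
      by (simp_all add: pf4_def wedge_def axis_def)
    moreover have "Z $ 3 $ 0 = 0" "Z $ 1 $ 0 = 0" "Z $ 2 $ 0 = 0" "Z $ 1 $ 3 = 1"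
      using linY[of 2 3 4 0] linY[of 1 2 4 0] linY[of 1 2 3 0] linY[of 1 2 3 4] \<open>Z $ 2 $ 4 = 0\<close>
      by (simp_all add: pf4_def wedge_def axis_def)
    moreover have "Z $ 2 $ 3 = 1"
      using linX[of 1 2 3 0] \<open>Z $ 1 $ 0 = 0\<close>
      by (simp add: pf4_def wedge_def axis_def)
    ultimately show ?thesis
      using skew[of 2 1] skew[of 3 1] skew[of 4 1] skew[of 0 1] skew[of 3 2] skew[of 4 2]
        skew[of 0 2] skew[of 4 3] skew[of 0 3] skew[of 0 4]
      by (simp add: vec_eq_iff forall_5 diag wedge_def axis_def)
  qed
  have "inj_on (\<lambda>Z. Z $ 1 $ 2) (rank2_common ?X ?Y)"
  proof (rule inj_onI)
    fix Z Z' assume Z: "Z \<in> rank2_common ?X ?Y" "Z' \<in> rank2_common ?X ?Y"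
      and eq: "Z $ 1 $ 2 = Z' $ 1 $ 2"
    have "Z = wedge (e 1) (Z $ 1 $ 2 *s e 2) + wedge (e 1) (e 3) + wedge (e 2) (e 3)"
      by (rule entries[OF Z(1)])
    also have "\<dots> = wedge (e 1) (Z' $ 1 $ 2 *s e 2) + wedge (e 1) (e 3) + wedge (e 2) (e 3)"
      by (simp only: eq)
    also have "\<dots> = Z'"
      by (rule entries[OF Z(2), symmetric])
    finally show "Z = Z'" .
  qed
  then have "card (rank2_common ?X ?Y) \<le> card (UNIV :: 'a set)"
    by (rule card_inj_on_le) auto
  then show ?thesis .
qed

theorem theorem6p13:
  fixes q :: nat
  assumes "primepow q" and "CARD('a::{field, finite}) = q"
  shows "\<not> triply_transitive (alt_adj :: ('a, 5) alt_mat \<Rightarrow> ('a, 5) alt_mat \<Rightarrow> bool)"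
proof
  assume "triply_transitive (alt_adj :: ('a, 5) alt_mat \<Rightarrow> ('a, 5) alt_mat \<Rightarrow> bool)"
  then obtain \<omega> :: "('a, 5) alt_mat"
    where T: "terwilliger0 alt_adj \<omega> = terwilliger alt_adj \<omega>"
    by (auto simp: triply_transitive_def)
  define X Y X' Y' :: "'a ^ 5 ^ 5"
    where "X = wedge (e 1) (e 2) + wedge (e 3) (e 4)"
      and "Y = wedge (e 1) (e 2 + e 3) + wedge (e 4) (e 2)"
      and "X' = wedge (e 1) (e 0) + wedge (e 2) (e 3)"
      and "Y' = wedge (e 2) (e 4) + wedge (e 1) (e 3)"
  note defs = X_def Y_def X'_def Y'_def
  have alt: "alternating X" "alternating Y" "alternating X'" "alternating Y'"
    by (simp_all add: defs alternating_add alternating_wedge)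
  \<comment> \<open>\<open>X'\<close> has radical \<open>e 4\<close>, so its Pfaffian must be taken
    on the indices 0 to 3.\<close>
  have pf: "pf4 X 1 2 3 4 \<noteq> 0" "pf4 Y 1 2 3 4 \<noteq> 0" "pf4 (X - Y) 1 2 3 4 \<noteq> 0"
    "pf4 X' 1 2 3 0 \<noteq> 0" "pf4 Y' 1 2 3 4 \<noteq> 0" "pf4 (X' - Y') 1 2 3 0 \<noteq> 0"
    by (simp_all add: defs pf4_def wedge_def axis_def)
  note nr = not_rank_2[OF alt(1) pf(1)] not_rank_2[OF alt(2) pf(2)]
    not_rank_2[OF alternating_diff[OF alt(1,2)] pf(3)]
    not_rank_2[OF alt(3) pf(4)] not_rank_2[OF alt(4) pf(5)]
    not_rank_2[OF alternating_diff[OF alt(3,4)] pf(6)]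
  have "card (rank2_common X Y) = card (rank2_common X' Y')"
    using T alt nr by (intro card_rank2_common_eq)
  moreover have "CARD('a)\<^sup>2 \<le> card (rank2_common X Y)"
    unfolding defs by (rule card_rank2_common_ge)
  moreover have "card (rank2_common X' Y') \<le> CARD('a)"
    unfolding defs by (rule card_rank2_common_le)
  ultimately have "CARD('a)\<^sup>2 \<le> CARD('a)"
    by simp
  \<comment> \<open>A field has at least two elements, which rules out
    \<open>q * q \<le> q\<close>.\<close>
  moreover have "card {0, 1 :: 'a} \<le> CARD('a)"
    by (rule card_mono) auto
  ultimately show False
    by (simp add: power2_eq_square)
qed

end
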